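(* Let $A \in \mathbb{R}^{m\times n}$, let $\alpha,\beta,\gamma,M>0$, and let $f:\mathbb{R}^m\times\mathbb{R}^n\to\mathbb{R}$ be $$f(u,v)=\frac12\sum_{i=1}^m\sum_{j=1}^n A_{ij}^2e^{2u_i+2v_j}-\alpha^2\mathbf{1}^Tu-\beta^2\mathbf{1}^Tv+\frac{\gamma}{2}\left(\|u\|_2^2+\|v\|_2^2\right).$$ Let $(u^\star,v^\star)$ be the unique minimizer of $f$ over $[-M,M]^m\times[-M,M]^n$. For $T\ge 1$, let $(\bar u,\bar v)$ be the (random) weighted average of iterates produced after $T$ iterations of the projected stochastic gradient method described in the context. Then $$\mathbb{E}\, f(\bar u,\bar v)-f(u^\star,v^\star)\le\frac{C}{\gamma(T+1)},$$ where the expectation is over the random iterates $(u^1,v^1),\ldots,(u^T,v^T)$, and $C$ is a constant bounded above by $$C\le\max_{(u,v)\in[-M,M]^m\times[-M,M]^n}2\,\mathbb{E}_{s,w}\|\tilde g(u,v,s,w)\|_2^2,$$ with $s\in\{-1,1\}^n$ and $w\in\{-1,1\}^m$ having i.i.d. uniform entries in $\{-1,1\}$. In particular the method converges in expectation to the optimal value with rate $O(1/T)$.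
   Context: $\mathbf{1}$ denotes the all-ones vector, and for a vector or matrix $X$, $|X|^2$ denotes the elementwise square of absolute values. For $u\in\mathbb{R}^m$, $v\in\mathbb{R}^n$ set $D=\operatorname{diag}(e^{u_1},\ldots,e^{u_m})$ and $E=\operatorname{diag}(e^{v_1},\ldots,e^{v_n})$. For $s\in\{-1,1\}^n$ and $w\in\{-1,1\}^m$ define $$\tilde g(u,v,s,w)=\begin{bmatrix}|DAEs|^2-\alpha^2\mathbf{1}+\gamma u\\ |EA^TDw|^2-\beta^2\mathbf{1}+\gamma v\end{bmatrix}\in\mathbb{R}^{m+n}.$$ The projected stochastic gradient method: start with $u^0=0$, $v^0=0$, $\bar u=0$, $\bar v=0$. For $t=1,\ldots,T$: draw, independently of everything before, $s\in\{-1,1\}^n$ and $w\in\{-1,1\}^m$ with i.i.d. uniform entries in $\{-1,1\}$; with $D,E$ formed from $(u^{t-1},v^{t-1})$, set $$u^t=\Pi_{[-M,M]^m}\!\left(u^{t-1}-\frac{2}{\gamma(t+1)}\left(|DAEs|^2-\alpha^2\mathbf{1}+\gamma u^{t-1}\right)\right),$$ $$v^t=\Pi_{[-M,M]^n}\!\left(v^{t-1}-\frac{2}{\gamma(t+1)}\left(|EA^TDw|^2-\beta^2\mathbf{1}+\gamma v^{t-1}\right)\right),$$ where $\Pi$ denotes Euclidean projection onto the indicated box; then update $\bar u\leftarrow\frac{2}{t+2}u^t+\frac{t}{t+2}\bar u$ and $\bar v\leftarrow\frac{2}{t+2}v^t+\frac{t}{t+2}\bar v$. Equivalently, after $T$ iterations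 $(\bar u,\bar v)=\sum_{t=0}^T\frac{2(t+1)}{(T+1)(T+2)}(u^t,v^t)$. *)

theory Defs
  imports "HOL-Probability.Probability" "HOL-Library.Landau_Symbols" "HOL-Library.Monad_Syntax"
begin

definition diag_mat :: "real ^ 'k \<Rightarrow> real ^ 'k ^ 'k" where
  "diag_mat d = (\<chi> i j. if i = j then d $ i else 0)"

definition exp_diag :: "real ^ 'k \<Rightarrow> real ^ 'k ^ 'k" where
  "exp_diag x = diag_mat (\<chi> i. exp (x $ i))"

definition abs_square :: "real ^ 'k \<Rightarrow> real ^ 'k" where
  "abs_square x = (\<chi> i. \<bar>x $ i\<bar>\<^sup>2)"

definition cube :: "real \<Rightarrow> (real ^ 'k) set" where
  "cube M = cbox (\<chi> i. - M) (\<chi> i. M)"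

text \<open>The numeral \<open>1\<close> in a vector type denotes the all-ones vector.\<close>

definition objective ::
  "real ^ 'n ^ 'm \<Rightarrow> real \<Rightarrow> real \<Rightarrow> real \<Rightarrow> (real ^ 'm) \<times> (real ^ 'n) \<Rightarrow> real" where
  "objective A \<alpha> \<beta> \<gamma> = (\<lambda>(u, v).
     1 / 2 * (\<Sum>i\<in>UNIV. \<Sum>j\<in>UNIV. (A $ i $ j)\<^sup>2 * exp (2 * u $ i + 2 * v $ j))
     - \<alpha>\<^sup>2 * (1 \<bullet> u) - \<beta>\<^sup>2 * (1 \<bullet> v) + \<gamma> / 2 * ((norm u)\<^sup>2 + (norm v)\<^sup>2))"

text \<open>Stacked vectors are pairs; the norm of the product type
  is the Euclidean norm of the stacked vector.\<close>

definition stoch_grad ::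
  "real ^ 'n ^ 'm \<Rightarrow> real \<Rightarrow> real \<Rightarrow> real \<Rightarrow> (real ^ 'm) \<times> (real ^ 'n)
    \<Rightarrow> real ^ 'n \<Rightarrow> real ^ 'm \<Rightarrow> (real ^ 'm) \<times> (real ^ 'n)" where
  "stoch_grad A \<alpha> \<beta> \<gamma> = (\<lambda>(u, v) s w.
     let D = exp_diag u; E = exp_diag v in
       (abs_square ((D ** A ** E) *v s) - \<alpha>\<^sup>2 *\<^sub>R 1 + \<gamma> *\<^sub>R u,
        abs_square ((E ** transpose A ** D) *v w) - \<beta>\<^sup>2 *\<^sub>R 1 + \<gamma> *\<^sub>R v))"

definition random_signs :: "(real ^ 'k) pmf" where
  "random_signs = map_pmf vec_lambda (Pi_pmf UNIV 0 (\<lambda>_. pmf_of_set {-1, 1}))"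

text \<open>The state is \<open>(u, v, ubar, vbar)\<close>; \<open>t\<close> is the number of the iteration, counted from 1.\<close>

definition psg_step ::
  "real ^ 'n ^ 'm \<Rightarrow> real \<Rightarrow> real \<Rightarrow> real \<Rightarrow> real \<Rightarrow> nat \<Rightarrow> real ^ 'n \<Rightarrow> real ^ 'm
    \<Rightarrow> (real ^ 'm) \<times> (real ^ 'n) \<times> (real ^ 'm) \<times> (real ^ 'n)
    \<Rightarrow> (real ^ 'm) \<times> (real ^ 'n) \<times> (real ^ 'm) \<times> (real ^ 'n)" where
  "psg_step A \<alpha> \<beta> \<gamma> M t s w = (\<lambda>(u, v, ubar, vbar).
     let (gu, gv) = stoch_grad A \<alpha> \<beta> \<gamma> (u, v) s w;
         \<eta> = 2 / (\<gamma> * (real t + 1));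
         u' = closest_point (cube M) (u - \<eta> *\<^sub>R gu);
         v' = closest_point (cube M) (v - \<eta> *\<^sub>R gv)
     in (u', v',
         (2 / (real t + 2)) *\<^sub>R u' + (real t / (real t + 2)) *\<^sub>R ubar,
         (2 / (real t + 2)) *\<^sub>R v' + (real t / (real t + 2)) *\<^sub>R vbar))"

primrec psg ::
  "real ^ 'n ^ 'm \<Rightarrow> real \<Rightarrow> real \<Rightarrow> real \<Rightarrow> real \<Rightarrow> nat
    \<Rightarrow> ((real ^ 'm) \<times> (real ^ 'n) \<times> (real ^ 'm) \<times> (real ^ 'n)) pmf" where
  "psg A \<alpha> \<beta> \<gamma> M 0 = return_pmf (0, 0, 0, 0)"
| "psg A \<alpha> \<beta> \<gamma> M (Suc t) = do {
     x \<leftarrow> psg A \<alpha> \<beta> \<gamma> M t;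
     s \<leftarrow> random_signs;
     w \<leftarrow> random_signs;
     return_pmf (psg_step A \<alpha> \<beta> \<gamma> M (Suc t) s w x)
   }"

definition expected_objective ::
  "real ^ 'n ^ 'm \<Rightarrow> real \<Rightarrow> real \<Rightarrow> real \<Rightarrow> real \<Rightarrow> nat \<Rightarrow> real" where
  "expected_objective A \<alpha> \<beta> \<gamma> M T =
     measure_pmf.expectation (psg A \<alpha> \<beta> \<gamma> M T)
       (\<lambda>(u, v, ubar, vbar). objective A \<alpha> \<beta> \<gamma> (ubar, vbar))"

definition grad_second_moment ::
  "real ^ 'n ^ 'm \<Rightarrow> real \<Rightarrow> real \<Rightarrow> real \<Rightarrow> (real ^ 'm) \<times> (real ^ 'n) \<Rightarrow> real" where
  "grad_second_moment A \<alpha> \<beta> \<gamma> z =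
     measure_pmf.expectation (pair_pmf random_signs random_signs)
       (\<lambda>(s, w). (norm (stoch_grad A \<alpha> \<beta> \<gamma> z s w))\<^sup>2)"

end

theory Submission imports Defs
begin

text \<open>The stochastic gradient is an unbiased estimate of the gradient of \<open>f\<close>, which is
  \<open>\<gamma>\<close>-strongly convex because \<open>exp\<close> lies above its tangents, and the projection does not increase
  the distance to the minimizer \<open>z\<^sup>*\<close>. So if \<open>B\<close> bounds the second moment of the stochastic gradient,
  the iterates \<open>z\<^sub>t = (u\<^sub>t, v\<^sub>t)\<close> satisfy
  \<open>(t+1) E (f z\<^sub>t - f z\<^sup>*) \<le> B/\<gamma> + \<gamma>/4 (t (t+1) E |z\<^sub>t - z\<^sup>*|\<^sup>2 - (t+1) (t+2) E |z\<^sub>t\<^sub>+\<^sub>1 - z\<^sup>*|\<^sup>2)\<close>.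
  The right-hand side telescopes, and by convexity the weighted average of the left-hand sides
  dominates the value of \<open>f\<close> at the averaged iterate.\<close>

section \<open>Expectations over random signs\<close>

text \<open>All distributions that occur have finite support, so every real function on them is
  integrable and integrability side conditions are discharged uniformly.\<close>

lemma expectation_mono_finite:
  fixes f g :: "'a \<Rightarrow> real"
  assumes "finite (set_pmf p)" "\<And>x. x \<in> set_pmf p \<Longrightarrow> f x \<le> g x"
  shows "measure_pmf.expectation p f \<le> measure_pmf.expectation p g"
  using assms by (intro integral_mono_AE) (auto simp: AE_measure_pmf_iff integrable_measure_pmf_finite)

lemma expectation_bind_finite:
  fixes h :: "'b \<Rightarrow> real"
  assumes "finite (set_pmf p)" "\<And>x. x \<in> set_pmf p \<Longrightarrow> finite (set_pmf (f x))"
  shows "measure_pmf.expectation (p \<bind> f) h =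
    measure_pmf.expectation p (\<lambda>x. measure_pmf.expectation (f x) h)"
  using assms
  by (subst pmf_expectation_bind[of "set_pmf p"]) (auto simp: integral_measure_pmf[of "set_pmf p"])

lemma finite_set_Pi_signs:
  "finite (set_pmf (Pi_pmf (UNIV :: 'k::finite set) (0::real) (\<lambda>_. pmf_of_set {-1, 1})))"
  by (subst set_Pi_pmf) (auto intro!: finite_PiE_dflt simp: o_def)

lemma finite_set_random_signs: "finite (set_pmf (random_signs :: (real ^ 'k) pmf))"
  by (simp add: random_signs_def finite_set_Pi_signs)

lemma random_signs_square:
  assumes "s \<in> set_pmf (random_signs :: (real ^ 'k) pmf)"
  shows "s $ j * s $ j = 1"
proof -
  have "s $ j = -1 \<or> s $ j = 1"
    using assms unfolding random_signs_def by (auto simp: set_Pi_pmf PiE_dflt_def)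
  then show ?thesis by auto
qed

lemma expectation_random_signs_component:
  "measure_pmf.expectation (random_signs :: (real ^ 'k) pmf) (\<lambda>s. s $ j) = 0"
proof -
  let ?P = "Pi_pmf (UNIV :: 'k set) (0::real) (\<lambda>_. pmf_of_set {-1, 1})"
  have "measure_pmf.expectation ?P (\<lambda>f. f j) =
      measure_pmf.expectation (map_pmf (\<lambda>f. f j) ?P) (\<lambda>x. x)"
    by simp
  also have "\<dots> = measure_pmf.expectation (pmf_of_set {-1, 1 :: real}) (\<lambda>x. x)"
    by (subst Pi_pmf_component) auto
  also have "\<dots> = 0"
    by (subst integral_pmf_of_set) auto
  finally show ?thesis
    by (simp add: random_signs_def)
qed

text \<open>Distinct coordinates are independent and centred. Independence enters through the
  product rule for \<open>Pi_pmf\<close>; expanding \<open>(1 + s $ j) * (1 + s $ k)\<close> and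
  removing the vanishing first moments isolates the mixed moment.\<close>

lemma expectation_random_signs_mult:
  assumes "j \<noteq> k"
  shows "measure_pmf.expectation (random_signs :: (real ^ 'k) pmf) (\<lambda>s. s $ j * s $ k) = 0"
proof -
  let ?P = "Pi_pmf (UNIV :: 'k set) (0::real) (\<lambda>_. pmf_of_set {-1, 1})"
  let ?R = "random_signs :: (real ^ 'k) pmf"
  let ?f = "\<lambda>i x. if i \<in> {j, k} then 1 + x else (1 :: real)"
  have int: "integrable (measure_pmf ?R) h" for h :: "real ^ 'k \<Rightarrow> real"
    by (simp add: integrable_measure_pmf_finite finite_set_random_signs)
  \<comment> \<open>The product rule needs nonnegative factors, hence the shift of the signs by one.\<close>
  have "measure_pmf.expectation ?P (\<lambda>y. \<Prod>i\<in>UNIV. ?f i (y i)) =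
      (\<Prod>i\<in>UNIV. measure_pmf.expectation (pmf_of_set {-1, 1 :: real}) (?f i))"
    by (rule expectation_prod_Pi_pmf) (auto intro!: integrable_measure_pmf_finite)
  \<comment> \<open>\<open>1 + x\<close> has mean 1 under a uniform sign, and the factors outside
    \<open>{j, k}\<close> are constantly 1.\<close>
  also have "\<dots> = 1"
    by (intro prod.neutral) (auto simp: integral_pmf_of_set)
  also have "(\<lambda>y. \<Prod>i\<in>UNIV. ?f i (y i)) = (\<lambda>y. (1 + y j) * (1 + y k))"
  proof
    fix y :: "'k \<Rightarrow> real"
    have "(\<Prod>i\<in>UNIV. ?f i (y i)) = (\<Prod>i\<in>{j, k}. 1 + y i)"
      by (simp only: prod.If_cases finite) (auto intro!: prod.cong)
    then show "(\<Prod>i\<in>UNIV. ?f i (y i)) = (1 + y j) * (1 + y k)"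
      using assms by simp
  qed
  finally have "measure_pmf.expectation ?R (\<lambda>s. (1 + s $ j) * (1 + s $ k)) = 1"
    by (simp add: random_signs_def)
  moreover have "(\<lambda>s::real^'k. (1 + s $ j) * (1 + s $ k)) = (\<lambda>s. 1 + s $ j + s $ k + s $ j * s $ k)"
    by (simp add: algebra_simps fun_eq_iff)
  moreover have "measure_pmf.expectation ?R (\<lambda>s. 1 + s $ j + s $ k + s $ j * s $ k) =
      1 + measure_pmf.expectation ?R (\<lambda>s. s $ j) + measure_pmf.expectation ?R (\<lambda>s. s $ k)
        + measure_pmf.expectation ?R (\<lambda>s. s $ j * s $ k)"
    by (simp add: Bochner_Integration.integral_add[OF int int])
  ultimately show ?thesis
    by (simp add: expectation_random_signs_component)
qed

text \<open>A random sign vector is isotropic: the mixed moments form the identity matrix, so only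
  the diagonal of the expanded square survives. This is what lets a single matrix-vector product
  estimate squared row norms.\<close>

lemma expectation_random_signs_inner_square:
  fixes c :: "real ^ 'k"
  shows "measure_pmf.expectation random_signs (\<lambda>s. (c \<bullet> s)\<^sup>2) = (\<Sum>j\<in>UNIV. (c $ j)\<^sup>2)"
proof -
  let ?R = "random_signs :: (real ^ 'k) pmf"
  have int: "integrable (measure_pmf ?R) h" for h :: "real ^ 'k \<Rightarrow> real"
    by (simp add: integrable_measure_pmf_finite finite_set_random_signs)
  have diag: "measure_pmf.expectation ?R (\<lambda>s. s $ j * s $ k) = (if j = k then 1 else 0)" for j k
  proof (cases "j = k")
    case True
    have "measure_pmf.expectation ?R (\<lambda>s. s $ j * s $ j) = measure_pmf.expectation ?R (\<lambda>_. 1)"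
      by (intro integral_cong_AE) (auto simp: AE_measure_pmf_iff random_signs_square)
    then show ?thesis using True by simp
  qed (simp add: expectation_random_signs_mult)
  have "measure_pmf.expectation ?R (\<lambda>s. (c \<bullet> s)\<^sup>2) =
      measure_pmf.expectation ?R (\<lambda>s. \<Sum>j\<in>UNIV. \<Sum>k\<in>UNIV. c $ j * c $ k * (s $ j * s $ k))"
    by (simp add: inner_vec_def power2_eq_square sum_product mult_ac)
  also have "\<dots> = (\<Sum>j\<in>UNIV. \<Sum>k\<in>UNIV. c $ j * c $ k * measure_pmf.expectation ?R (\<lambda>s. s $ j * s $ k))"
    by (simp add: Bochner_Integration.integral_sum int)
  also have "\<dots> = (\<Sum>j\<in>UNIV. (c $ j)\<^sup>2)"
    by (simp add: diag power2_eq_square if_distrib[of "\<lambda>x. _ * x"] cong: if_cong)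
  finally show ?thesis .
qed

section \<open>The gradient and strong convexity\<close>

text \<open>The gradient of \<open>objective\<close> in closed form: the 2 from differentiating the
  exponent cancels the leading \<open>1 / 2\<close>.\<close>

definition full_grad ::
  "real ^ 'n ^ 'm \<Rightarrow> real \<Rightarrow> real \<Rightarrow> real \<Rightarrow> (real ^ 'm) \<times> (real ^ 'n) \<Rightarrow> (real ^ 'm) \<times> (real ^ 'n)" where
  "full_grad A \<alpha> \<beta> \<gamma> = (\<lambda>(u, v).
     ((\<chi> i. \<Sum>j\<in>UNIV. (A $ i $ j)\<^sup>2 * exp (2 * u $ i + 2 * v $ j)) - \<alpha>\<^sup>2 *\<^sub>R 1 + \<gamma> *\<^sub>R u,
      (\<chi> j. \<Sum>i\<in>UNIV. (A $ i $ j)\<^sup>2 * exp (2 * u $ i + 2 * v $ j)) - \<beta>\<^sup>2 *\<^sub>R 1 + \<gamma> *\<^sub>R v))"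

lemma exp_diag_scaling:
  fixes A :: "real ^ 'n ^ 'm"
  shows "(exp_diag u ** A ** exp_diag v) $ i $ j = exp (u $ i) * A $ i $ j * exp (v $ j)"
  by (simp add: matrix_matrix_mult_def exp_diag_def diag_mat_def
      if_distrib[of "\<lambda>x. _ * x"] if_distrib[of "\<lambda>x. x * _"] cong: if_cong)

lemma expectation_abs_square_signs:
  fixes B :: "real ^ 'k ^ 'l"
  shows "measure_pmf.expectation random_signs (\<lambda>s. abs_square (B *v s) $ i) = (\<Sum>j\<in>UNIV. (B $ i $ j)\<^sup>2)"
  by (simp add: abs_square_def matrix_vector_mul_component expectation_random_signs_inner_square)

text \<open>Unbiasedness is tested against a vector \<open>y\<close> to keep expectations
  real-valued; later \<open>y\<close> is the displacement from the comparison point. The two blocks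
  depend on \<open>s\<close> and \<open>w\<close> separately, so only the marginals of the pair
  matter.\<close>

lemma expectation_stoch_grad_inner:
  fixes A :: "real ^ 'n ^ 'm"
  shows "measure_pmf.expectation (pair_pmf random_signs random_signs)
      (\<lambda>(s, w). stoch_grad A \<alpha> \<beta> \<gamma> z s w \<bullet> y) = full_grad A \<alpha> \<beta> \<gamma> z \<bullet> y"
proof -
  obtain u v where z: "z = (u, v)" by (cases z)
  obtain a b where y: "y = (a, b)" by (cases y)
  let ?S = "random_signs :: (real ^ 'n) pmf" and ?W = "random_signs :: (real ^ 'm) pmf"
  let ?P = "pair_pmf ?S ?W"
  let ?B = "exp_diag u ** A ** exp_diag v" and ?C = "exp_diag v ** transpose A ** exp_diag u"
  have int: "integrable (measure_pmf ?P) h" for h :: "_ \<Rightarrow> real"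
    by (simp add: integrable_measure_pmf_finite finite_set_random_signs)
  let ?r = "(- \<alpha>\<^sup>2 *\<^sub>R 1 + \<gamma> *\<^sub>R u) \<bullet> a + (- \<beta>\<^sup>2 *\<^sub>R 1 + \<gamma> *\<^sub>R v) \<bullet> b"
  have sq: "(exp x * c * exp t)\<^sup>2 = c\<^sup>2 * exp (2 * x + 2 * t)" for x c t :: real
    by (simp add: power_mult_distrib exp_add exp_double[symmetric] mult_ac)
  have fst: "measure_pmf.expectation ?P (\<lambda>x. abs_square (?B *v fst x) $ i) =
      (\<Sum>j\<in>UNIV. (A $ i $ j)\<^sup>2 * exp (2 * u $ i + 2 * v $ j))" for i
  proof -
    have "measure_pmf.expectation ?P (\<lambda>x. abs_square (?B *v fst x) $ i) =
        measure_pmf.expectation (map_pmf fst ?P) (\<lambda>s. abs_square (?B *v s) $ i)"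
      by (simp only: integral_map_pmf)
    then show ?thesis
      by (simp add: map_fst_pair_pmf expectation_abs_square_signs exp_diag_scaling sq)
  qed
  \<comment> \<open>\<open>?C\<close> is the transpose of \<open>?B\<close>, so its squared row
    norms are column sums of the same scaled entries.\<close>
  have snd: "measure_pmf.expectation ?P (\<lambda>x. abs_square (?C *v snd x) $ j) =
      (\<Sum>i\<in>UNIV. (A $ i $ j)\<^sup>2 * exp (2 * u $ i + 2 * v $ j))" for j
  proof -
    have "measure_pmf.expectation ?P (\<lambda>x. abs_square (?C *v snd x) $ j) =
        measure_pmf.expectation (map_pmf snd ?P) (\<lambda>s. abs_square (?C *v s) $ j)"
      by (simp only: integral_map_pmf)
    then show ?thesis
      by (simp add: map_snd_pair_pmf expectation_abs_square_signs exp_diag_scaling sq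
          transpose_def add.commute)
  qed
  have "measure_pmf.expectation ?P (\<lambda>(s, w). stoch_grad A \<alpha> \<beta> \<gamma> z s w \<bullet> y) =
      measure_pmf.expectation ?P (\<lambda>x. (\<Sum>i\<in>UNIV. abs_square (?B *v fst x) $ i * a $ i)
        + (\<Sum>j\<in>UNIV. abs_square (?C *v snd x) $ j * b $ j) + ?r)"
    by (simp add: z y stoch_grad_def Let_def case_prod_unfold inner_add_left inner_diff_left
        inner_vec_def[of "abs_square _"] algebra_simps)
  also have "\<dots> = (\<Sum>i\<in>UNIV. measure_pmf.expectation ?P (\<lambda>x. abs_square (?B *v fst x) $ i) * a $ i)
      + (\<Sum>j\<in>UNIV. measure_pmf.expectation ?P (\<lambda>x. abs_square (?C *v snd x) $ j) * b $ j) + ?r"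
    by (simp add: Bochner_Integration.integral_add int Bochner_Integration.integral_sum)
  also have "\<dots> = full_grad A \<alpha> \<beta> \<gamma> z \<bullet> y"
    unfolding fst snd
    by (simp add: z y full_grad_def inner_add_left inner_diff_left
        inner_vec_def[of "vec_lambda _"] algebra_simps)
  finally show ?thesis .
qed

text \<open>The exponential terms obey a tangent inequality, the linear terms are exact, and
  expanding the regularizer exactly leaves \<open>\<gamma> / 2\<close> times the squared
  distance.\<close>

lemma objective_strong_convexity:
  fixes A :: "real ^ 'n ^ 'm"
  shows "objective A \<alpha> \<beta> \<gamma> y \<ge> objective A \<alpha> \<beta> \<gamma> x + full_grad A \<alpha> \<beta> \<gamma> x \<bullet> (y - x) + \<gamma> / 2 * (norm (y - x))\<^sup>2"
proof -
  obtain u v where x: "x = (u, v)" by (cases x)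
  obtain u' v' where y: "y = (u', v')" by (cases y)
  define c where "c i j = (A $ i $ j)\<^sup>2 * exp (2 * u $ i + 2 * v $ j)" for i j
  define c' where "c' i j = (A $ i $ j)\<^sup>2 * exp (2 * u' $ i + 2 * v' $ j)" for i j
  have tangent: "c i j / 2 + c i j * ((u' - u) $ i + (v' - v) $ j) \<le> c' i j / 2" for i j
  proof -
    define p q where "p = 2 * u $ i + 2 * v $ j" and "q = 2 * u' $ i + 2 * v' $ j"
    \<comment> \<open>The bound \<open>1 + x \<le> exp x\<close> at \<open>x = q - p\<close>, scaled
      to the base point \<open>p\<close>.\<close>
    have "exp p * (1 + (q - p)) \<le> exp p * exp (q - p)"
      by (intro mult_left_mono exp_ge_add_one_self) auto
    then have "exp p * (1 + (q - p)) \<le> exp q"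
      by (simp add: exp_diff)
    then have "(A $ i $ j)\<^sup>2 * (exp p * (1 + (q - p))) \<le> (A $ i $ j)\<^sup>2 * exp q"
      by (intro mult_left_mono) auto
    then show ?thesis
      unfolding c_def c'_def p_def[symmetric] q_def[symmetric]
      by (simp add: p_def q_def algebra_simps)
  qed
  have "(\<Sum>i\<in>UNIV. \<Sum>j\<in>UNIV. c i j / 2 + c i j * ((u' - u) $ i + (v' - v) $ j)) \<le> (\<Sum>i\<in>UNIV. \<Sum>j\<in>UNIV. c' i j / 2)"
    by (intro sum_mono tangent)
  also have "(\<Sum>i\<in>UNIV. \<Sum>j\<in>UNIV. c i j / 2 + c i j * ((u' - u) $ i + (v' - v) $ j)) =
      1 / 2 * (\<Sum>i\<in>UNIV. \<Sum>j\<in>UNIV. c i j) + (\<Sum>i\<in>UNIV. \<Sum>j\<in>UNIV. c i j * (u' - u) $ i)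
        + (\<Sum>i\<in>UNIV. \<Sum>j\<in>UNIV. c i j * (v' - v) $ j)"
    by (simp add: sum.distrib ring_distribs sum_divide_distrib del: vector_minus_component)
  also have "(\<Sum>i\<in>UNIV. \<Sum>j\<in>UNIV. c i j * (u' - u) $ i) = (\<chi> i. \<Sum>j\<in>UNIV. c i j) \<bullet> (u' - u)"
    by (simp add: inner_vec_def sum_distrib_right del: vector_minus_component)
  also have "(\<Sum>i\<in>UNIV. \<Sum>j\<in>UNIV. c i j * (v' - v) $ j) = (\<chi> j. \<Sum>i\<in>UNIV. c i j) \<bullet> (v' - v)"
    by (subst sum.swap) (simp add: inner_vec_def sum_distrib_right del: vector_minus_component)
  finally have smooth: "1 / 2 * (\<Sum>i\<in>UNIV. \<Sum>j\<in>UNIV. c i j) + (\<chi> i. \<Sum>j\<in>UNIV. c i j) \<bullet> (u' - u)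
      + (\<chi> j. \<Sum>i\<in>UNIV. c i j) \<bullet> (v' - v) \<le> 1 / 2 * (\<Sum>i\<in>UNIV. \<Sum>j\<in>UNIV. c' i j)"
    by (simp add: sum_divide_distrib)
  have quad: "\<gamma> / 2 * (norm b)\<^sup>2 = \<gamma> / 2 * (norm a)\<^sup>2 + \<gamma> * (a \<bullet> (b - a)) + \<gamma> / 2 * (norm (b - a))\<^sup>2"
    for a b :: "'b::real_inner"
    by (simp add: power2_norm_eq_inner inner_diff_left inner_diff_right inner_commute algebra_simps)
  have normP: "(norm (y - x))\<^sup>2 = (norm (u' - u))\<^sup>2 + (norm (v' - v))\<^sup>2"
    by (simp add: x y norm_Pair)
  have gr: "full_grad A \<alpha> \<beta> \<gamma> x \<bullet> (y - x) =
      (\<chi> i. \<Sum>j\<in>UNIV. c i j) \<bullet> (u' - u) - \<alpha>\<^sup>2 * (1 \<bullet> (u' - u)) + \<gamma> * (u \<bullet> (u' - u))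
      + ((\<chi> j. \<Sum>i\<in>UNIV. c i j) \<bullet> (v' - v) - \<beta>\<^sup>2 * (1 \<bullet> (v' - v)) + \<gamma> * (v \<bullet> (v' - v)))"
    by (simp add: x y full_grad_def c_def inner_add_left inner_diff_left)
  have lin: "1 \<bullet> (a - b) = 1 \<bullet> a - 1 \<bullet> b" for a b :: "real ^ 'z"
    by (simp add: inner_diff_right)
  have ox: "objective A \<alpha> \<beta> \<gamma> x = 1 / 2 * (\<Sum>i\<in>UNIV. \<Sum>j\<in>UNIV. c i j)
      - \<alpha>\<^sup>2 * (1 \<bullet> u) - \<beta>\<^sup>2 * (1 \<bullet> v) + \<gamma> / 2 * (norm u)\<^sup>2 + \<gamma> / 2 * (norm v)\<^sup>2"
    by (simp add: x objective_def c_def ring_distribs)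
  have oy: "objective A \<alpha> \<beta> \<gamma> y = 1 / 2 * (\<Sum>i\<in>UNIV. \<Sum>j\<in>UNIV. c' i j)
      - \<alpha>\<^sup>2 * (1 \<bullet> u') - \<beta>\<^sup>2 * (1 \<bullet> v') + \<gamma> / 2 * (norm u')\<^sup>2 + \<gamma> / 2 * (norm v')\<^sup>2"
    by (simp add: y objective_def c'_def ring_distribs)
  show ?thesis
    unfolding ox oy gr normP lin right_diff_distrib distrib_left[of "\<gamma> / 2"]
    using smooth quad[of u' u] quad[of v' v] by linarith
qed

text \<open>Both values are bounded below by the tangent at the combined point; in the weighted sum
  the first-order terms cancel because the weighted displacements add up to zero.\<close>

lemma objective_convex_combination:
  assumes "0 \<le> a" "0 \<le> b" "a + b = 1" "\<gamma> \<ge> 0"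
  shows "objective A \<alpha> \<beta> \<gamma> (a *\<^sub>R x + b *\<^sub>R y) \<le> a * objective A \<alpha> \<beta> \<gamma> x + b * objective A \<alpha> \<beta> \<gamma> y"
proof -
  let ?z = "a *\<^sub>R x + b *\<^sub>R y"
  let ?f = "objective A \<alpha> \<beta> \<gamma>" and ?g = "full_grad A \<alpha> \<beta> \<gamma> ?z"
  have tangent: "?f ?z + ?g \<bullet> (p - ?z) \<le> ?f p" for p
  proof -
    have "0 \<le> \<gamma> / 2 * (norm (p - ?z))\<^sup>2" using assms by simp
    then show ?thesis using objective_strong_convexity[of A \<alpha> \<beta> \<gamma> ?z p] by linarith
  qed
  have "a *\<^sub>R (x - ?z) + b *\<^sub>R (y - ?z) = ?z - (a + b) *\<^sub>R ?z"
    by (simp add: scaleR_diff_right scaleR_add_left)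
  then have zero: "a *\<^sub>R (x - ?z) + b *\<^sub>R (y - ?z) = 0"
    using assms by simp
  have "a * (?f ?z + ?g \<bullet> (x - ?z)) + b * (?f ?z + ?g \<bullet> (y - ?z)) =
      (a + b) * ?f ?z + ?g \<bullet> (a *\<^sub>R (x - ?z) + b *\<^sub>R (y - ?z))"
    by (simp only: inner_add_right inner_scaleR_right ring_distribs)
  then have "?f ?z = a * (?f ?z + ?g \<bullet> (x - ?z)) + b * (?f ?z + ?g \<bullet> (y - ?z))"
    by (simp only: zero assms(3)) simp
  also have "\<dots> \<le> a * ?f x + b * ?f y"
    using assms by (intro add_mono mult_left_mono tangent)
  finally show ?thesis .
qed

section \<open>Extrema over the box\<close>

lemma cube_props:
  fixes M :: real
  assumes "M > 0"
  shows "0 \<in> (cube M :: (real ^ 'k) set)" "convex (cube M :: (real ^ 'k) set)"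
    "closed (cube M :: (real ^ 'k) set)" "compact (cube M :: (real ^ 'k) set)"
    "(cube M :: (real ^ 'k) set) \<noteq> {}"
proof -
  show "0 \<in> (cube M :: (real ^ 'k) set)"
    using assms by (simp add: cube_def mem_box_cart)
  then show "(cube M :: (real ^ 'k) set) \<noteq> {}" by blast
qed (auto simp: cube_def closed_cbox compact_cbox)

lemma continuous_on_objective: "continuous_on S (objective A \<alpha> \<beta> \<gamma>)"
  unfolding objective_def case_prod_unfold
  by (intro continuous_intros)

lemma continuous_on_stoch_grad: "continuous_on S (\<lambda>z. stoch_grad A \<alpha> \<beta> \<gamma> z s w)"
  unfolding stoch_grad_def case_prod_unfold Let_def abs_square_def matrix_vector_mul_component
    inner_vec_def exp_diag_scaling
  by (simp, intro continuous_intros)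

text \<open>Finite support turns the expectation into a finite sum of continuous functions of the
  point; compactness of the box then yields the maximum in the theorem.\<close>

lemma continuous_on_grad_second_moment: "continuous_on S (grad_second_moment A \<alpha> \<beta> \<gamma>)"
proof -
  let ?P = "pair_pmf random_signs random_signs"
  have "grad_second_moment A \<alpha> \<beta> \<gamma> =
      (\<lambda>z. \<Sum>x\<in>set_pmf ?P. pmf ?P x * (norm (stoch_grad A \<alpha> \<beta> \<gamma> z (fst x) (snd x)))\<^sup>2)"
    unfolding grad_second_moment_def case_prod_unfold
    by (subst integral_measure_pmf[of "set_pmf ?P"]) (auto simp: finite_set_random_signs)
  then show ?thesis
    by (auto intro!: continuous_intros continuous_on_stoch_grad)
qed

text \<open>Existence is compactness. For uniqueness, strong convexity is applied at the midpoint of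
  two minimizers: the first-order terms are opposite, and neither minimizer has a larger value than
  the midpoint, which forces their distance to vanish.\<close>

lemma objective_ex1_arg_min:
  fixes A :: "real ^ 'n ^ 'm"
  assumes "\<gamma> > 0" "M > 0"
  shows "\<exists>!z. is_arg_min (objective A \<alpha> \<beta> \<gamma>) (\<lambda>z. z \<in> cube M \<times> cube M) z"
proof -
  let ?K = "cube M \<times> cube M :: ((real ^ 'm) \<times> (real ^ 'n)) set"
  let ?f = "objective A \<alpha> \<beta> \<gamma>"
  have "\<exists>z\<in>?K. \<forall>y\<in>?K. ?f z \<le> ?f y"
    by (intro continuous_attains_inf compact_Times continuous_on_objective)
      (auto simp: cube_props[OF assms(2)])
  then have ex: "\<exists>z. is_arg_min ?f (\<lambda>z. z \<in> ?K) z"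
    by (auto simp: is_arg_min_linorder)
  have "x = y" if x: "is_arg_min ?f (\<lambda>z. z \<in> ?K) x" and y: "is_arg_min ?f (\<lambda>z. z \<in> ?K) y" for x y
  proof -
    let ?z = "(1/2) *\<^sub>R x + (1/2) *\<^sub>R y"
    let ?g = "full_grad A \<alpha> \<beta> \<gamma> ?z"
    have "convex ?K"
      by (intro convex_Times cube_props[OF assms(2)])
    moreover have "x \<in> ?K" "y \<in> ?K" using x y by (auto simp: is_arg_min_def)
    ultimately have "?z \<in> ?K"
      by (intro convexD) auto
    then have le: "?f x \<le> ?f ?z" "?f y \<le> ?f ?z"
      using x y by (auto simp: is_arg_min_linorder)
    have dx: "x - ?z = (1/2) *\<^sub>R (x - y)" and dy: "y - ?z = - ((1/2) *\<^sub>R (x - y))"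
      by (auto simp: algebra_simps simp flip: scaleR_add_left)
    have "?f ?z + ?g \<bullet> ((1/2) *\<^sub>R (x - y)) + \<gamma> / 2 * (norm ((1/2) *\<^sub>R (x - y)))\<^sup>2 \<le> ?f x"
      using objective_strong_convexity[of A \<alpha> \<beta> \<gamma> ?z x] by (simp only: dx)
    moreover have "?f ?z - ?g \<bullet> ((1/2) *\<^sub>R (x - y)) + \<gamma> / 2 * (norm ((1/2) *\<^sub>R (x - y)))\<^sup>2 \<le> ?f y"
      using objective_strong_convexity[of A \<alpha> \<beta> \<gamma> ?z y] by (simp only: dy inner_minus_right norm_minus_cancel)
    ultimately have "\<gamma> * (norm ((1/2) *\<^sub>R (x - y)))\<^sup>2 \<le> 0"
      using le by argo
    then have "(norm ((1/2) *\<^sub>R (x - y)))\<^sup>2 \<le> 0"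
      using assms by (simp add: mult_le_0_iff)
    then show "x = y" by simp
  qed
  with ex show ?thesis by blast
qed

section \<open>The Lyapunov argument\<close>

lemma closest_point_cube_contraction:
  fixes x p :: "real ^ 'k"
  assumes "M > 0" "p \<in> cube M"
  shows "(norm (closest_point (cube M) x - p))\<^sup>2 \<le> (norm (x - p))\<^sup>2"
  using closest_point_lipschitz[of "cube M" x p] cube_props[OF assms(1), where 'k='k] assms
  by (auto simp: closest_point_self dist_norm intro!: power_mono)

text \<open>Projecting each block onto its box fixes the components of \<open>p\<close> and is
  nonexpansive, so it suffices to expand the squared distance of the unprojected step.\<close>

lemma psg_step_contraction:
  fixes A :: "real ^ 'n ^ 'm"
  assumes "M > 0" "p \<in> cube M \<times> cube M" "psg_step A \<alpha> \<beta> \<gamma> M t s w (u, v, a, b) = (u', v', a', b')"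
  defines "\<eta> \<equiv> 2 / (\<gamma> * (real t + 1))" and "g \<equiv> stoch_grad A \<alpha> \<beta> \<gamma> (u, v) s w"
  shows "(norm ((u', v') - p))\<^sup>2 \<le>
      (norm ((u, v) - p))\<^sup>2 - 2 * \<eta> * (g \<bullet> ((u, v) - p)) + \<eta>\<^sup>2 * (norm g)\<^sup>2"
proof -
  obtain p1 p2 where p: "p = (p1, p2)" by (cases p)
  obtain g1 g2 where g: "g = (g1, g2)" by (cases g)
  have uv: "u' = closest_point (cube M) (u - \<eta> *\<^sub>R g1)" "v' = closest_point (cube M) (v - \<eta> *\<^sub>R g2)"
    using assms(3) g unfolding psg_step_def g_def \<eta>_def by (auto simp: Let_def)
  have "(norm ((u', v') - p))\<^sup>2 = (norm (u' - p1))\<^sup>2 + (norm (v' - p2))\<^sup>2"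
    by (simp add: p norm_Pair)
  also have "\<dots> \<le> (norm (u - \<eta> *\<^sub>R g1 - p1))\<^sup>2 + (norm (v - \<eta> *\<^sub>R g2 - p2))\<^sup>2"
    using assms(1,2) unfolding uv p by (intro add_mono closest_point_cube_contraction) auto
  also have "\<dots> = (norm (((u, v) - p) - \<eta> *\<^sub>R g))\<^sup>2"
    by (simp add: p g norm_Pair algebra_simps)
  also have "\<dots> = (norm ((u, v) - p))\<^sup>2 - 2 * \<eta> * (g \<bullet> ((u, v) - p)) + \<eta>\<^sup>2 * (norm g)\<^sup>2"
    unfolding power2_norm_eq_inner inner_diff_left inner_diff_right inner_scaleR_left inner_scaleR_right
    by (simp add: inner_commute power2_eq_square algebra_simps)
  finally show ?thesis .
qed

lemma psg_step_average:
  assumes "psg_step A \<alpha> \<beta> \<gamma> M t s w (u, v, a, b) = (u', v', a', b')"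
  shows "(a', b') = (2 / (real t + 2)) *\<^sub>R (u', v') + (real t / (real t + 2)) *\<^sub>R (a, b)"
  using assms by (auto simp: psg_step_def Let_def split: prod.splits)

text \<open>Both draws are merged into one draw from the product distribution, the form in which the
  one-step estimates are stated.\<close>

lemma psg_Suc:
  "psg A \<alpha> \<beta> \<gamma> M (Suc t) = psg A \<alpha> \<beta> \<gamma> M t \<bind>
    (\<lambda>x. map_pmf (\<lambda>(s, w). psg_step A \<alpha> \<beta> \<gamma> M (Suc t) s w x) (pair_pmf random_signs random_signs))"
  by (simp add: pair_pmf_def map_bind_pmf)

lemma finite_set_psg: "finite (set_pmf (psg A \<alpha> \<beta> \<gamma> M t))"
proof (induction t)
  case (Suc t)
  then show ?case
    unfolding psg_Suc by (auto simp: finite_set_random_signs)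
qed simp

lemma psg_in_cube:
  fixes A :: "real ^ 'n ^ 'm"
  assumes "M > 0" "(u, v, a, b) \<in> set_pmf (psg A \<alpha> \<beta> \<gamma> M t)"
  shows "(u, v) \<in> cube M \<times> cube M"
proof (cases t)
  case 0
  then show ?thesis using assms(2) by (auto simp: cube_props(1)[OF assms(1)])
next
  case (Suc k)
  have closest: "closest_point (cube M) x \<in> cube M" for x :: "real ^ 'z"
    using cube_props[OF assms(1), where 'k='z] by (intro closest_point_in_set)
  then show ?thesis
    using assms(2) unfolding Suc psg_Suc
    by (auto simp: psg_step_def Let_def closest split: prod.splits)
qed

text \<open>The first coefficient is the total weight \<open>1 + ... + (t + 1)\<close> of the
  average. Along a run, convexity bounds the first two terms by the weighted errors of the iterates
  before the current one; the third is the distance term left by telescoping.\<close>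

definition lyapunov ::
  "real ^ 'n ^ 'm \<Rightarrow> real \<Rightarrow> real \<Rightarrow> real \<Rightarrow> (real ^ 'm) \<times> (real ^ 'n) \<Rightarrow> nat
    \<Rightarrow> (real ^ 'm) \<times> (real ^ 'n) \<times> (real ^ 'm) \<times> (real ^ 'n) \<Rightarrow> real" where
  "lyapunov A \<alpha> \<beta> \<gamma> p t = (\<lambda>(u, v, a, b).
     (real t + 1) * (real t + 2) / 2 * (objective A \<alpha> \<beta> \<gamma> (a, b) - objective A \<alpha> \<beta> \<gamma> p)
     - (real t + 1) * (objective A \<alpha> \<beta> \<gamma> (u, v) - objective A \<alpha> \<beta> \<gamma> p)
     + \<gamma> / 4 * real t * (real t + 1) * (norm ((u, v) - p))\<^sup>2)"

text \<open>The step size makes the coefficient \<open>\<gamma> / 4 * (t + 1) * (t + 2)\<close> of the new squared distance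
  equal to \<open>(t + 1) / (2 * \<eta>)\<close>, so that the strong convexity term turns it into
  \<open>\<gamma> / 4 * t * (t + 1)\<close>.\<close>

lemma expected_distance_step:
  fixes A :: "real ^ 'n ^ 'm" and a u :: "real ^ 'm" and b v :: "real ^ 'n" and t :: nat
  assumes "\<gamma> > 0" "M > 0" "p \<in> cube M \<times> cube M"
    and B: "grad_second_moment A \<alpha> \<beta> \<gamma> (u, v) \<le> B"
  defines "step_at \<equiv> \<lambda>s w. psg_step A \<alpha> \<beta> \<gamma> M (Suc t) s w (u, v, a, b)"
  shows "\<gamma> / 4 * (real t + 1) * (real t + 2) *
      measure_pmf.expectation (pair_pmf random_signs random_signs)
        (\<lambda>(s, w). (norm ((fst (step_at s w), fst (snd (step_at s w))) - p))\<^sup>2)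
    \<le> \<gamma> / 4 * real t * (real t + 1) * (norm ((u, v) - p))\<^sup>2
      - (real t + 1) * (objective A \<alpha> \<beta> \<gamma> (u, v) - objective A \<alpha> \<beta> \<gamma> p) + B / \<gamma>"
proof -
  let ?P = "pair_pmf random_signs random_signs :: ((real ^ 'n) \<times> (real ^ 'm)) pmf"
  let ?g = "\<lambda>x. stoch_grad A \<alpha> \<beta> \<gamma> (u, v) (fst x) (snd x)"
  let ?d = "(norm ((u, v) - p))\<^sup>2"
  \<comment> \<open>The iteration is number \<open>t + 1\<close>, hence \<open>t + 2\<close> in the
    denominator.\<close>
  define \<eta> where "\<eta> = 2 / (\<gamma> * (real t + 2))"
  define k where "k = \<gamma> / 4 * (real t + 1) * (real t + 2)"
  define E where "E = measure_pmf.expectation ?P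
        (\<lambda>(s, w). (norm ((fst (step_at s w), fst (snd (step_at s w))) - p))\<^sup>2)"
  define G where "G = full_grad A \<alpha> \<beta> \<gamma> (u, v) \<bullet> ((u, v) - p)"
  define m where "m = grad_second_moment A \<alpha> \<beta> \<gamma> (u, v)"
  define F where "F = objective A \<alpha> \<beta> \<gamma> (u, v) - objective A \<alpha> \<beta> \<gamma> p"
  have int: "integrable (measure_pmf ?P) h" for h :: "_ \<Rightarrow> real"
    by (simp add: integrable_measure_pmf_finite finite_set_random_signs)
  have "E \<le> measure_pmf.expectation ?P
      (\<lambda>x. ?d - 2 * \<eta> * (?g x \<bullet> ((u, v) - p)) + \<eta>\<^sup>2 * (norm (?g x))\<^sup>2)"
    unfolding E_def
  proof (rule expectation_mono_finite)
    fix x :: "(real ^ 'n) \<times> (real ^ 'm)"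
    obtain s w where x: "x = (s, w)" by (cases x)
    obtain u' v' a' b' where n: "step_at s w = (u', v', a', b')" by (metis prod_cases4)
    have "2 / (\<gamma> * (real (Suc t) + 1)) = \<eta>" by (simp add: \<eta>_def add_ac)
    then show "(case x of (s, w) \<Rightarrow> (norm ((fst (step_at s w), fst (snd (step_at s w))) - p))\<^sup>2)
        \<le> ?d - 2 * \<eta> * (?g x \<bullet> ((u, v) - p)) + \<eta>\<^sup>2 * (norm (?g x))\<^sup>2"
      using psg_step_contraction[OF assms(2,3) n[unfolded step_at_def]]
      by (simp only: x n prod.case fst_conv snd_conv)
  qed (simp add: finite_set_random_signs)
  also have "\<dots> = ?d - 2 * \<eta> * measure_pmf.expectation ?P (\<lambda>x. ?g x \<bullet> ((u, v) - p))
      + \<eta>\<^sup>2 * measure_pmf.expectation ?P (\<lambda>x. (norm (?g x))\<^sup>2)"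
    by (simp only: Bochner_Integration.integral_add[OF int int] Bochner_Integration.integral_diff[OF int int]
        integral_mult_right_zero) simp
  also have "\<dots> = ?d - 2 * \<eta> * G + \<eta>\<^sup>2 * m"
    using expectation_stoch_grad_inner[of A \<alpha> \<beta> \<gamma> "(u, v)" "(u, v) - p"]
    by (simp add: G_def m_def grad_second_moment_def case_prod_unfold)
  finally have E: "E \<le> ?d - 2 * \<eta> * G + \<eta>\<^sup>2 * m" .
  \<comment> \<open>The strong convexity inequality at the current iterate, evaluated at
    \<open>p\<close>, bounds the mean descent \<open>G\<close> from below.\<close>
  have "full_grad A \<alpha> \<beta> \<gamma> (u, v) \<bullet> (p - (u, v)) = - G"
    unfolding G_def by (simp add: inner_diff_right)
  then have G: "F + \<gamma> / 2 * ?d \<le> G"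
    using objective_strong_convexity[of A \<alpha> \<beta> \<gamma> "(u, v)" p]
    by (simp add: F_def norm_minus_commute)
  have pos: "real t + 1 > 0" "real t + 2 > 0" "\<gamma> * (real t + 2) \<noteq> 0" using assms(1) by auto
  have k\<eta>: "k * \<eta> = (real t + 1) / 2"
    using pos assms(1) by (simp add: k_def \<eta>_def field_simps)
  have "k * \<eta>\<^sup>2 = (k * \<eta>) * \<eta>" by (simp add: power2_eq_square)
  also have "\<dots> = (real t + 1) / 2 * (2 / (\<gamma> * (real t + 2)))"
    by (simp only: k\<eta>) (simp only: \<eta>_def)
  also have "\<dots> = (real t + 1) / (real t + 2) / \<gamma>"
    by (simp only: times_divide_times_eq divide_divide_eq_left mult.commute[of \<gamma>]
        mult_divide_mult_cancel_right[of 2] mult.commute[of 2])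
  finally have k\<eta>2: "k * \<eta>\<^sup>2 = (real t + 1) / (real t + 2) / \<gamma>" .
  have "0 \<le> k" using assms(1) by (simp add: k_def)
  then have "k * E \<le> k * (?d - 2 * \<eta> * G + \<eta>\<^sup>2 * m)"
    using E by (rule mult_left_mono[rotated])
  also have "\<dots> = k * ?d - 2 * (k * \<eta>) * G + k * \<eta>\<^sup>2 * m"
    by (simp add: algebra_simps)
  also have "\<dots> = k * ?d - (real t + 1) * G + (real t + 1) / (real t + 2) / \<gamma> * m"
    by (simp add: k\<eta> k\<eta>2)
  \<comment> \<open>\<open>G\<close> is replaced by its lower bound, and the factor
    \<open>(t + 1) / (t + 2)\<close> of the nonnegative second moment is at most 1.\<close>
  also have "\<dots> \<le> k * ?d - (real t + 1) * (F + \<gamma> / 2 * ?d) + B / \<gamma>"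
  proof -
    have m: "0 \<le> m" unfolding m_def grad_second_moment_def by (intro integral_nonneg_AE) auto
    have "(real t + 1) / (real t + 2) * m \<le> 1 * m"
      using m by (intro mult_right_mono) auto
    then have "(real t + 1) / (real t + 2) * m \<le> B" using B m_def by linarith
    then have "(real t + 1) / (real t + 2) * m / \<gamma> \<le> B / \<gamma>"
      using assms(1) by (intro divide_right_mono) auto
    then have "(real t + 1) / (real t + 2) / \<gamma> * m \<le> B / \<gamma>"
      by (simp only: times_divide_eq_left)
    moreover have "(real t + 1) * (F + \<gamma> / 2 * ?d) \<le> (real t + 1) * G"
      using G by (intro mult_left_mono) auto
    ultimately show ?thesis by linarith
  qed
  also have "\<dots> = \<gamma> / 4 * real t * (real t + 1) * ?d - (real t + 1) * F + B / \<gamma>"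
    by (simp add: k_def field_simps)
  finally show ?thesis by (simp add: k_def E_def F_def)
qed

text \<open>By convexity the new average brings in the error of the new iterate with exactly the
  weight that the potential subtracts. Only the old average and the new squared distance remain, and
  the latter is controlled in expectation by \<open>expected_distance_step\<close>.\<close>

lemma lyapunov_step:
  fixes A :: "real ^ 'n ^ 'm"
  assumes "\<gamma> > 0" "M > 0" "p \<in> cube M \<times> cube M"
    and "grad_second_moment A \<alpha> \<beta> \<gamma> (u, v) \<le> B"
  shows "measure_pmf.expectation (pair_pmf random_signs random_signs)
      (\<lambda>(s, w). lyapunov A \<alpha> \<beta> \<gamma> p (Suc t) (psg_step A \<alpha> \<beta> \<gamma> M (Suc t) s w (u, v, a, b)))
    \<le> lyapunov A \<alpha> \<beta> \<gamma> p t (u, v, a, b) + B / \<gamma>"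
proof -
  let ?P = "pair_pmf random_signs random_signs :: ((real ^ 'n) \<times> (real ^ 'm)) pmf"
  define step_at where "step_at s w = psg_step A \<alpha> \<beta> \<gamma> M (Suc t) s w (u, v, a, b)" for s w
  let ?F = "\<lambda>z. objective A \<alpha> \<beta> \<gamma> z - objective A \<alpha> \<beta> \<gamma> p"
  define k where "k = \<gamma> / 4 * (real t + 1) * (real t + 2)"
  define c where "c = (real t + 1) * (real t + 2) / 2 * ?F (a, b)"
  have int: "integrable (measure_pmf ?P) h" for h :: "_ \<Rightarrow> real"
    by (simp add: integrable_measure_pmf_finite finite_set_random_signs)
  have le: "lyapunov A \<alpha> \<beta> \<gamma> p (Suc t) (step_at s w) \<le> c + k * (norm ((fst (step_at s w), fst (snd (step_at s w))) - p))\<^sup>2"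
    for s w
  proof -
    obtain u' v' a' b' where n: "step_at s w = (u', v', a', b')" by (metis prod_cases4)
    \<comment> \<open>\<open>q\<close> is the denominator of the averaging weights in iteration
      \<open>t + 1\<close>.\<close>
    define q where "q = real t + 3"
    have q: "q > 0" "real t = q - 3" by (auto simp: q_def)
    have "(a', b') = (2 / q) *\<^sub>R (u', v') + ((q - 2) / q) *\<^sub>R (a, b)"
      using psg_step_average[OF n[unfolded step_at_def]] by (simp add: q_def add_ac)
    then have "objective A \<alpha> \<beta> \<gamma> (a', b') \<le>
        2 / q * objective A \<alpha> \<beta> \<gamma> (u', v') + (q - 2) / q * objective A \<alpha> \<beta> \<gamma> (a, b)"
      by (simp only:) (rule objective_convex_combination,
        use assms(1) in \<open>auto simp: q_def simp flip: add_divide_distrib\<close>)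
    then have "?F (a', b') \<le> 2 / q * ?F (u', v') + (q - 2) / q * ?F (a, b)"
      using q(1) by (simp add: field_simps)
    \<comment> \<open>The total weight after the step is \<open>(q - 1) * q / 2\<close>. It turns
      \<open>2 / q\<close> into \<open>q - 1 = t + 2\<close>, the subtracted coefficient, and
      \<open>(q - 2) / q\<close> into the total weight before the step.\<close>
    then have "(q - 1) * q / 2 * ?F (a', b') \<le> (q - 1) * q / 2 * (2 / q * ?F (u', v') + (q - 2) / q * ?F (a, b))"
      by (intro mult_left_mono) (auto simp: q_def)
    also have "\<dots> = (q - 1) * ?F (u', v') + (q - 2) * (q - 1) / 2 * ?F (a, b)"
      using q(1) by (simp add: field_simps)
    finally show ?thesis
      unfolding n lyapunov_def c_def k_def by (simp add: q(2) algebra_simps)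
  qed
  have "measure_pmf.expectation ?P (\<lambda>(s, w). lyapunov A \<alpha> \<beta> \<gamma> p (Suc t) (step_at s w))
    \<le> measure_pmf.expectation ?P
        (\<lambda>x. c + k * (case x of (s, w) \<Rightarrow> (norm ((fst (step_at s w), fst (snd (step_at s w))) - p))\<^sup>2))"
    using le by (intro expectation_mono_finite) (auto simp: finite_set_random_signs)
  also have "\<dots> = c + k * measure_pmf.expectation ?P
      (\<lambda>(s, w). (norm ((fst (step_at s w), fst (snd (step_at s w))) - p))\<^sup>2)"
    by (simp only: Bochner_Integration.integral_add[OF int int] integral_mult_right_zero) simp
  also have "\<dots> \<le> lyapunov A \<alpha> \<beta> \<gamma> p t (u, v, a, b) + B / \<gamma>"
    using expected_distance_step[OF assms, of t a b]
    unfolding step_at_def k_def c_def lyapunov_def by simp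
  finally show ?thesis unfolding step_at_def .
qed

text \<open>Conditioning on the state after \<open>t\<close> iterations, each step adds at most
  \<open>B / \<gamma>\<close>; the bound \<open>B\<close> applies because every reachable iterate
  lies in the box.\<close>

lemma expected_lyapunov:
  fixes A :: "real ^ 'n ^ 'm"
  assumes "\<gamma> > 0" "M > 0" "p \<in> cube M \<times> cube M"
    and B: "\<And>z. z \<in> cube M \<times> cube M \<Longrightarrow> grad_second_moment A \<alpha> \<beta> \<gamma> z \<le> B"
  shows "measure_pmf.expectation (psg A \<alpha> \<beta> \<gamma> M t) (lyapunov A \<alpha> \<beta> \<gamma> p t) \<le> real t * B / \<gamma>"
proof (induction t)
  case 0
  \<comment> \<open>Iterate and average both start at zero, so the first two terms cancel, and the
    factor \<open>t\<close> removes the distance.\<close>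
  then show ?case by (simp add: lyapunov_def)
next
  case (Suc t)
  let ?Q = "psg A \<alpha> \<beta> \<gamma> M t"
  have int: "integrable (measure_pmf ?Q) h" for h :: "_ \<Rightarrow> real"
    by (simp add: integrable_measure_pmf_finite finite_set_psg)
  have "measure_pmf.expectation (psg A \<alpha> \<beta> \<gamma> M (Suc t)) (lyapunov A \<alpha> \<beta> \<gamma> p (Suc t)) =
      measure_pmf.expectation ?Q (\<lambda>x. measure_pmf.expectation (pair_pmf random_signs random_signs)
        (\<lambda>(s, w). lyapunov A \<alpha> \<beta> \<gamma> p (Suc t) (psg_step A \<alpha> \<beta> \<gamma> M (Suc t) s w x)))"
    unfolding psg_Suc
    by (subst expectation_bind_finite) (auto simp: finite_set_psg finite_set_random_signs case_prod_unfold)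
  also have "\<dots> \<le> measure_pmf.expectation ?Q (\<lambda>x. lyapunov A \<alpha> \<beta> \<gamma> p t x + B / \<gamma>)"
  proof (intro expectation_mono_finite finite_set_psg)
    fix x assume x: "x \<in> set_pmf ?Q"
    obtain u v a b where x_eq: "x = (u, v, a, b)" by (metis prod_cases4)
    have "grad_second_moment A \<alpha> \<beta> \<gamma> (u, v) \<le> B"
      by (rule B[OF psg_in_cube[OF assms(2) x[unfolded x_eq]]])
    then show "measure_pmf.expectation (pair_pmf random_signs random_signs)
        (\<lambda>(s, w). lyapunov A \<alpha> \<beta> \<gamma> p (Suc t) (psg_step A \<alpha> \<beta> \<gamma> M (Suc t) s w x))
        \<le> lyapunov A \<alpha> \<beta> \<gamma> p t x + B / \<gamma>"
      unfolding x_eq by (rule lyapunov_step[OF assms(1-3)])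
  qed
  also have "\<dots> = measure_pmf.expectation ?Q (lyapunov A \<alpha> \<beta> \<gamma> p t) + B / \<gamma>"
    by (simp only: Bochner_Integration.integral_add[OF int int]) simp
  also have "\<dots> \<le> real (Suc t) * B / \<gamma>"
    using Suc by (simp add: algebra_simps add_divide_distrib)
  finally show ?case .
qed

section \<open>From the potential to the expected value at the average\<close>

lemma expected_objective_bound:
  fixes A :: "real ^ 'n ^ 'm"
  assumes "\<gamma> > 0" "M > 0" "p \<in> cube M \<times> cube M"
    and B: "\<And>z. z \<in> cube M \<times> cube M \<Longrightarrow> grad_second_moment A \<alpha> \<beta> \<gamma> z \<le> B"
  shows "expected_objective A \<alpha> \<beta> \<gamma> M T - objective A \<alpha> \<beta> \<gamma> p \<le> 2 * B / (\<gamma> * (real T + 2))"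
proof -
  let ?Q = "psg A \<alpha> \<beta> \<gamma> M T"
  let ?F = "\<lambda>z. objective A \<alpha> \<beta> \<gamma> z - objective A \<alpha> \<beta> \<gamma> p"
  define k where "k = (real T + 1) * (real T + 2) / 2"
  have int: "integrable (measure_pmf ?Q) h" for h :: "_ \<Rightarrow> real"
    by (simp add: integrable_measure_pmf_finite finite_set_psg)
  have k: "k > 0" by (simp add: k_def)
  \<comment> \<open>The last iterate enters the average without a descent step; a fictitious further step,
    after which the squared distance is only known to be nonnegative, accounts for it.\<close>
  have "measure_pmf.expectation ?Q (\<lambda>(u, v, a, b). k * ?F (a, b)) \<le>
      measure_pmf.expectation ?Q (\<lambda>x. lyapunov A \<alpha> \<beta> \<gamma> p T x + B / \<gamma>)"
  proof (intro expectation_mono_finite finite_set_psg)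
    fix x assume x: "x \<in> set_pmf ?Q"
    obtain u v a b where x_eq: "x = (u, v, a, b)" by (metis prod_cases4)
    have "grad_second_moment A \<alpha> \<beta> \<gamma> (u, v) \<le> B"
      by (rule B[OF psg_in_cube[OF assms(2) x[unfolded x_eq]]])
    note step = expected_distance_step[OF assms(1-3) this, of T a b]
    have "0 \<le> \<gamma> / 4 * real T * (real T + 1) * (norm ((u, v) - p))\<^sup>2
      - (real T + 1) * ?F (u, v) + B / \<gamma>"
      by (rule order_trans[OF _ step])
        (use assms(1) in \<open>auto intro!: mult_nonneg_nonneg integral_nonneg_AE simp: case_prod_unfold\<close>)
    then show "(case x of (u, v, a, b) \<Rightarrow> k * ?F (a, b)) \<le> lyapunov A \<alpha> \<beta> \<gamma> p T x + B / \<gamma>"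
      by (simp add: x_eq lyapunov_def k_def)
  qed
  also have "\<dots> = measure_pmf.expectation ?Q (lyapunov A \<alpha> \<beta> \<gamma> p T) + B / \<gamma>"
    by (simp only: Bochner_Integration.integral_add[OF int int]) simp
  also have "\<dots> \<le> (real T + 1) * B / \<gamma>"
    using expected_lyapunov[OF assms] by (simp add: algebra_simps add_divide_distrib)
  also have "measure_pmf.expectation ?Q (\<lambda>(u, v, a, b). k * ?F (a, b)) =
      k * (expected_objective A \<alpha> \<beta> \<gamma> M T - objective A \<alpha> \<beta> \<gamma> p)"
    unfolding expected_objective_def case_prod_unfold integral_mult_right_zero
    by (simp only: Bochner_Integration.integral_diff[OF int int]) simp
  finally have "expected_objective A \<alpha> \<beta> \<gamma> M T - objective A \<alpha> \<beta> \<gamma> p \<le> (real T + 1) * B / \<gamma> / k"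
    using k by (simp only: pos_le_divide_eq mult.commute)
  \<comment> \<open>The factor \<open>T + 1\<close>, counting the \<open>T\<close> steps and the
    fictitious one, cancels against the total weight \<open>k\<close>.\<close>
  also have "\<dots> = 2 * B / (\<gamma> * (real T + 2))"
    using assms(1) by (simp add: k_def divide_simps)
  finally show ?thesis .
qed

text \<open>The averages are convex combinations of points of the box and thus stay in it. With the
  minimum as \<open>c\<close> this makes the expected error nonnegative, as the two-sided bound
  behind \<open>O(1/T)\<close> requires.\<close>

lemma expected_objective_ge:
  fixes A :: "real ^ 'n ^ 'm"
  assumes "M > 0" "\<And>z. z \<in> cube M \<times> cube M \<Longrightarrow> c \<le> objective A \<alpha> \<beta> \<gamma> z"
  shows "c \<le> expected_objective A \<alpha> \<beta> \<gamma> M T"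
proof -
  let ?Q = "psg A \<alpha> \<beta> \<gamma> M"
  have avg: "(a, b) \<in> cube M \<times> cube M" if "(u, v, a, b) \<in> set_pmf (?Q T)" for u v a b
    using that
  proof (induction T arbitrary: u v a b)
    case 0
    then show ?case by (auto simp: cube_props(1)[OF assms(1)])
  next
    case (Suc t)
    from Suc.prems obtain s w u0 v0 a0 b0 where x0: "(u0, v0, a0, b0) \<in> set_pmf (?Q t)"
      and st: "psg_step A \<alpha> \<beta> \<gamma> M (Suc t) s w (u0, v0, a0, b0) = (u, v, a, b)"
      unfolding psg_Suc by auto
    have K: "convex (cube M \<times> cube M :: ((real ^ 'm) \<times> (real ^ 'n)) set)"
      by (intro convex_Times cube_props[OF assms(1)])
    show ?case
      unfolding psg_step_average[OF st]
      using psg_in_cube[OF assms(1) Suc.prems] Suc.IH[OF x0]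
      by (intro convexD[OF K]) (auto simp flip: add_divide_distrib)
  qed
  have "measure_pmf.expectation (?Q T) (\<lambda>_. c) \<le> expected_objective A \<alpha> \<beta> \<gamma> M T"
    unfolding expected_objective_def
    by (intro expectation_mono_finite finite_set_psg) (use avg assms(2) in auto)
  then show ?thesis by simp
qed

section \<open>The explicit error bound and the rate \<open>O(1/T)\<close>\<close>

theorem mainTheorem1:
  fixes A :: "real ^ 'n ^ 'm" and \<alpha> \<beta> \<gamma> M :: real
  assumes "\<alpha> > 0" and "\<beta> > 0" and "\<gamma> > 0" and "M > 0"
  shows
    "(\<exists>!z. is_arg_min (objective A \<alpha> \<beta> \<gamma>) (\<lambda>z. z \<in> cube M \<times> cube M) z) \<and>
     (\<forall>ustar vstar.
        is_arg_min (objective A \<alpha> \<beta> \<gamma>) (\<lambda>z. z \<in> cube M \<times> cube M) (ustar, vstar) \<longrightarrow>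
        (\<exists>C zmax.
           is_arg_max (\<lambda>z. 2 * grad_second_moment A \<alpha> \<beta> \<gamma> z) (\<lambda>z. z \<in> cube M \<times> cube M) zmax \<and>
           C \<le> 2 * grad_second_moment A \<alpha> \<beta> \<gamma> zmax \<and>
           (\<forall>T\<ge>1. expected_objective A \<alpha> \<beta> \<gamma> M T - objective A \<alpha> \<beta> \<gamma> (ustar, vstar)
                     \<le> C / (\<gamma> * (real T + 1)))) \<and>
        (\<lambda>T. expected_objective A \<alpha> \<beta> \<gamma> M T - objective A \<alpha> \<beta> \<gamma> (ustar, vstar))
          \<in> O(\<lambda>T. 1 / real T))"
proof (intro conjI allI impI)
  show "\<exists>!z. is_arg_min (objective A \<alpha> \<beta> \<gamma>) (\<lambda>z. z \<in> cube M \<times> cube M) z"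
    using assms by (intro objective_ex1_arg_min)
next
  fix ustar :: "real ^ 'm" and vstar :: "real ^ 'n"
  let ?K = "cube M \<times> cube M :: ((real ^ 'm) \<times> (real ^ 'n)) set"
  let ?S = "grad_second_moment A \<alpha> \<beta> \<gamma>"
  let ?err = "\<lambda>T. expected_objective A \<alpha> \<beta> \<gamma> M T - objective A \<alpha> \<beta> \<gamma> (ustar, vstar)"
  assume min: "is_arg_min (objective A \<alpha> \<beta> \<gamma>) (\<lambda>z. z \<in> ?K) (ustar, vstar)"
  have "\<exists>z\<in>?K. \<forall>y\<in>?K. ?S y \<le> ?S z"
    by (intro continuous_attains_sup compact_Times continuous_on_grad_second_moment)
      (auto simp: cube_props[OF assms(4)])
  then obtain zmax where zmax: "zmax \<in> ?K" "\<And>y. y \<in> ?K \<Longrightarrow> ?S y \<le> ?S zmax" by blast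
  have S0: "0 \<le> ?S zmax"
    unfolding grad_second_moment_def by (intro integral_nonneg_AE) auto
  have bound: "?err T \<le> 2 * ?S zmax / (\<gamma> * (real T + 1))" for T
  proof -
    have "?err T \<le> 2 * ?S zmax / (\<gamma> * (real T + 2))"
      using min zmax assms by (intro expected_objective_bound) (auto simp: is_arg_min_def)
    \<comment> \<open>Weakening \<open>T + 2\<close> to \<open>T + 1\<close> uses that the second
      moment is nonnegative.\<close>
    also have "\<dots> \<le> 2 * ?S zmax / (\<gamma> * (real T + 1))"
      using S0 assms(3) by (intro divide_left_mono mult_left_mono) auto
    finally show ?thesis .
  qed
  have "is_arg_max (\<lambda>z. 2 * ?S z) (\<lambda>z. z \<in> ?K) zmax"
    using zmax by (auto simp: is_arg_max_linorder)
  \<comment> \<open>\<open>C\<close> is the maximum \<open>2 * ?S zmax\<close> itself, which does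
    not depend on \<open>T\<close>.\<close>
  then show "\<exists>C zmax. is_arg_max (\<lambda>z. 2 * ?S z) (\<lambda>z. z \<in> ?K) zmax \<and> C \<le> 2 * ?S zmax \<and>
      (\<forall>T\<ge>1. ?err T \<le> C / (\<gamma> * (real T + 1)))"
    using bound by blast
  have nonneg: "0 \<le> ?err T" for T
  proof -
    have "objective A \<alpha> \<beta> \<gamma> (ustar, vstar) \<le> expected_objective A \<alpha> \<beta> \<gamma> M T"
      using min by (intro expected_objective_ge[OF assms(4)]) (auto simp: is_arg_min_linorder)
    then show ?thesis by simp
  qed
  show "?err \<in> O(\<lambda>T. 1 / real T)"
  \<comment> \<open>The constant comes from weakening \<open>T + 1\<close> further to
    \<open>T\<close>, which is positive eventually.\<close>
  proof (rule bigoI[of _ "2 * ?S zmax / \<gamma>"], rule eventually_mono[OF eventually_gt_at_top[of 0]])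
    fix T :: nat assume T: "0 < T"
    have "?err T \<le> 2 * ?S zmax / (\<gamma> * (real T + 1))" by (rule bound)
    also have "\<dots> \<le> 2 * ?S zmax / (\<gamma> * real T)"
      using S0 assms(3) T by (intro divide_left_mono mult_left_mono) auto
    finally show "norm (?err T) \<le> 2 * ?S zmax / \<gamma> * norm (1 / real T)"
      using nonneg[of T] by simp
  qed
qed

end
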